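(* Let $\phi=\frac{1+\sqrt5}{2}$. Then $$\operatorname{Li}_2\left(1-\frac{1+\sqrt{1+\frac4\phi}}{2\phi}\right)-\operatorname{Li}_2\left(\frac{1-\sqrt{1+\frac4\phi}}{2\phi}\right)=-\frac12\log^2(\phi)+\log\left(\frac{2}{\sqrt{\frac4\phi+1}+1}\right)\log(\phi)+\frac{\pi^2}{15}.$$
   Context: $\operatorname{Li}_2(z)=\sum_{k\ge1}z^k/k^2$ for $|z|\le 1$ is the dilogarithm; $\log$ is the natural logarithm and $\log^2(y)=(\log y)^2$. *)

theory Defs
  imports Complex_Main
begin

(* The n-th summand is the term k = n + 1 of the series; the sum is meaningful
   for norm z \<le> 1, where the series converges absolutely. *)
definition Li2 :: "'a :: {real_normed_field, banach} \<Rightarrow> 'a" where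
  "Li2 z = (\<Sum>n. z ^ Suc n / of_nat (Suc n) ^ 2)"

end

theory Submission
  imports Defs "HOL-Analysis.Analysis" "HOL-Real_Asymp.Real_Asymp"
begin

(* Write q = 1 - y + y^2.  The identity
     Li2 (y / q) - Li2 (y^2 / q) + Li2 (- y (1 - y) / q) = ln (1 - y) ln q - (ln q)^2 / 2,
   proved by differentiation, is the five-term relation for x = y / q and y (two of whose
   five terms cancel, as x (1 - y) / (1 - x y) = y), combined with Landen's identity.
   With s = sqrt (1 + 4 / phi) and y = (s - 1) / (s + 1), its last two arguments are those
   of the theorem and y / q = 1 / phi^2.  The value Li2 (1 / phi^2) = pi^2 / 15 - (ln phi)^2
   results from the reflection, Landen and duplication formulas, which are three linear
   equations in the values of Li2 at 1 / phi^2, 1 / phi and - 1 / phi. *)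

section \<open>Derivative and continuity of the real dilogarithm\<close>

lemma Li2_0 [simp]: "Li2 0 = 0"
  by (simp add: Li2_def)

lemma Li2_1: "Li2 (1::real) = pi\<^sup>2 / 6"
  using inverse_squares_sums by (simp add: Li2_def sums_iff add.commute)

text \<open>Termwise differentiation cancels one factor \<open>Suc n\<close> of each denominator and
  leaves the logarithm series divided by \<open>x\<close>. The point 0 is excluded because there the
  derivative is 1, whereas the quotient is 0 by the convention for division by zero.\<close>

lemma Li2_has_real_derivative:
  fixes x :: real
  assumes "\<bar>x\<bar> < 1" "x \<noteq> 0"
  shows "(Li2 has_real_derivative - ln (1 - x) / x) (at x)"
proof -
  let ?f = "\<lambda>n. 1 / real (Suc n) ^ 2"
  have coeff: "?f n * real (Suc n) * z ^ n = z ^ n / real (Suc n)" for n and z :: real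
    by (simp add: power2_eq_square del: of_nat_Suc)
  have summable: "summable (\<lambda>n. z ^ n / real (Suc n))" if "z \<in> {-1<..<1}" for z :: real
  proof (rule summable_comparison_test')
    show "summable (\<lambda>n. \<bar>z\<bar> ^ n)"
      using that by (intro summable_geometric) auto
    show "norm (z ^ n / real (Suc n)) \<le> \<bar>z\<bar> ^ n" for n
      by (simp add: power_abs divide_le_eq mult_le_cancel_left1)
  qed
  have "((\<lambda>x. \<Sum>n. ?f n * x ^ Suc n) has_real_derivative
      (\<Sum>n. ?f n * real (Suc n) * x ^ n)) (at x)"
    using assms summable by (intro DERIV_power_series'[where R = 1]) (auto simp only: coeff, auto)
  moreover have "(\<lambda>x. \<Sum>n. ?f n * x ^ Suc n) = Li2"
    by (simp add: fun_eq_iff Li2_def)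
  moreover have "(\<Sum>n. ?f n * real (Suc n) * x ^ n) = - ln (1 - x) / x"
  proof -
    have "ln (1 - x) = (\<Sum>n. (-1) ^ n * (1 / real (n + 1)) * ((1 - x) - 1) ^ Suc n)"
      using assms by (intro ln_series) auto
    also have "\<dots> = (\<Sum>n. - x * (x ^ n / real (Suc n)))"
    proof (rule suminf_cong)
      fix n
      have "(-1) ^ n * (- x) ^ n = x ^ n"
        by (simp flip: power_mult_distrib)
      then show "(-1) ^ n * (1 / real (n + 1)) * ((1 - x) - 1) ^ Suc n = - x * (x ^ n / real (Suc n))"
        by simp
    qed
    also have "\<dots> = - x * (\<Sum>n. x ^ n / real (Suc n))"
      using assms by (intro suminf_mult summable) auto
    finally show ?thesis
      using assms unfolding coeff by simp
  qed
  ultimately show ?thesis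
    by metis
qed

text \<open>The derivative \<open>E\<close> is tied to the chain rule by a separate equation, so
  that each use can supply an already simplified form.\<close>

lemma Li2_compose_has_real_derivative:
  fixes f :: "real \<Rightarrow> real"
  assumes "(f has_real_derivative D) (at x)" "\<bar>f x\<bar> < 1" "f x \<noteq> 0"
    and "E = - ln (1 - f x) / f x * D"
  shows "((\<lambda>x. Li2 (f x)) has_real_derivative E) (at x)"
  using DERIV_chain2[OF Li2_has_real_derivative assms(1)] assms(2-4) by simp

text \<open>The summands are dominated by \<open>1 / real (Suc n) ^ 2\<close> on the closed
  interval. Both ends matter: the reflection formula takes a limit at 1, and Landen's identity
  reaches -1 when \<open>x\<close> is 1/2.\<close>

lemma continuous_on_Li2: "continuous_on {-1..1::real} Li2"
proof -
  let ?s = "\<lambda>(N::nat) z. \<Sum>n<N. z ^ Suc n / real (Suc n) ^ 2"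
  have "uniform_limit {-1..1::real} ?s (\<lambda>z. \<Sum>n. z ^ Suc n / real (Suc n) ^ 2) sequentially"
  proof (rule Weierstrass_m_test)
    show "summable (\<lambda>n. 1 / real (Suc n) ^ 2)"
      using inverse_squares_sums by (simp add: sums_iff add.commute)
    show "norm (z ^ Suc n / real (Suc n) ^ 2) \<le> 1 / real (Suc n) ^ 2"
      if "z \<in> {-1..1}" for n and z :: real
    proof -
      have "\<bar>z\<bar> ^ Suc n \<le> 1"
        using that by (intro power_le_one) auto
      then show ?thesis
        by (simp add: power_abs divide_right_mono del: of_nat_Suc power_Suc)
    qed
  qed
  then have "continuous_on {-1..1::real} (\<lambda>z. \<Sum>n. z ^ Suc n / real (Suc n) ^ 2)"
    by (rule uniform_limit_theorem[rotated])
      (auto intro!: always_eventually continuous_intros simp del: of_nat_Suc)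
  then show ?thesis
    by (simp add: Li2_def[abs_def])
qed

lemma continuous_on_Li2_compose:
  fixes f :: "real \<Rightarrow> real"
  assumes "continuous_on S f" "\<And>x. x \<in> S \<Longrightarrow> \<bar>f x\<bar> \<le> 1"
  shows "continuous_on S (\<lambda>x. Li2 (f x))"
  by (rule continuous_on_compose2[OF continuous_on_Li2 assms(1)]) (use assms(2) in force)

section \<open>Reflection, Landen and duplication formulas\<close>

lemma Li2_reflection:
  fixes x :: real
  assumes "0 < x" "x < 1"
  shows "Li2 x + Li2 (1 - x) = pi\<^sup>2 / 6 - ln x * ln (1 - x)"
proof -
  define f where "f = (\<lambda>x::real. Li2 x + Li2 (1 - x) + ln x * ln (1 - x))"
  have "(f has_real_derivative 0) (at z)" if z: "0 < z" "z < 1" for z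
  proof -
    have "((\<lambda>z. Li2 (1 - z)) has_real_derivative ln z / (1 - z)) (at z)"
      using z by (intro Li2_compose_has_real_derivative[where D = "-1"])
        (auto intro!: derivative_eq_intros)
    then show ?thesis
      unfolding f_def using z
      by (auto intro!: derivative_eq_intros Li2_has_real_derivative)
  qed
  then have "\<exists>c. \<forall>z\<in>{0<..<1}. f z = c"
    by (intro has_field_derivative_zero_constant)
      (auto intro: has_field_derivative_at_within)
  then have "f z = f x" if "0 < z" "z < 1" for z
    using that assms by (metis greaterThanLessThan_iff)
  \<comment> \<open>The constant is identified by a limit from the right at 0 instead of a value
    there, because the factor \<open>ln z\<close> is unbounded near 0.\<close>
  then have "\<forall>\<^sub>F z in at_right 0. f z = f x"
    using eventually_at_right_less[of "0::real"] eventually_at_right_real[of 0 "1::real"]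
    by (auto elim: eventually_mono)
  then have "(f \<longlongrightarrow> f x) (at_right 0)"
    by (rule tendsto_eventually)
  moreover have "(f \<longlongrightarrow> Li2 0 + Li2 (1 - 0) + 0) (at_right 0)"
  proof -
    have "continuous_on {0..1::real} (\<lambda>z. Li2 z + Li2 (1 - z))"
      by (intro continuous_intros continuous_on_Li2_compose) auto
    then have "((\<lambda>z. Li2 z + Li2 (1 - z)) \<longlongrightarrow> Li2 0 + Li2 (1 - 0)) (at (0::real) within {0..1})"
      unfolding continuous_on_def by (rule bspec) simp
    then have "((\<lambda>z. Li2 z + Li2 (1 - z)) \<longlongrightarrow> Li2 0 + Li2 (1 - 0)) (at_right (0::real))"
      by (simp add: at_within_Icc_at_right)
    moreover have "((\<lambda>z::real. ln z * ln (1 - z)) \<longlongrightarrow> 0) (at_right 0)"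
      by real_asymp
    ultimately show ?thesis
      unfolding f_def by (rule tendsto_add)
  qed
  ultimately have "f x = Li2 0 + Li2 (1 - 0) + 0"
    by (rule tendsto_unique[rotated]) simp
  then show ?thesis
    by (simp add: f_def Li2_1)
qed

text \<open>The derivatives of the three terms cancel by the partial fractions 1/(z(1 - z)) = 1/z +
  1/(1 - z), and both sides vanish at 0. The bound \<open>x \<le> 1 / 2\<close> keeps the second
  argument in [-1, 0].\<close>

lemma Li2_Landen:
  fixes x :: real
  assumes "0 < x" "x \<le> 1 / 2"
  shows "Li2 x + Li2 (- x / (1 - x)) = - (ln (1 - x))\<^sup>2 / 2"
proof -
  define f where "f = (\<lambda>x::real. Li2 x + Li2 (- x / (1 - x)) + (ln (1 - x))\<^sup>2 / 2)"
  have "f x = f 0"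
  proof (rule DERIV_isconst_end[OF assms(1)])
    show "continuous_on {0..x} f"
      unfolding f_def using assms
      by (intro continuous_intros continuous_on_Li2_compose) (auto simp: field_simps)
    show "(f has_real_derivative 0) (at z)" if "0 < z" "z < x" for z
    proof -
      have z: "0 < z" "z < 1 / 2"
        using that assms by auto
      have "1 - (- z / (1 - z)) = 1 / (1 - z)"
        using z by (simp add: field_simps)
      then have ln_eq: "ln (1 - (- z / (1 - z))) = - ln (1 - z)"
        using z by (simp add: ln_div)
      have "((\<lambda>z. - z / (1 - z)) has_real_derivative - 1 / (1 - z)\<^sup>2) (at z)"
        using z by (auto intro!: derivative_eq_intros simp: field_simps power2_eq_square)
      moreover have "- (- ln (1 - z)) / (- z / (1 - z)) * (- 1 / (1 - z)\<^sup>2)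
          = ln (1 - z) / (z * (1 - z))"
        using z by (simp add: divide_simps power2_eq_square)
      ultimately have "((\<lambda>z. Li2 (- z / (1 - z))) has_real_derivative
          ln (1 - z) / (z * (1 - z))) (at z)"
        using z ln_eq by (intro Li2_compose_has_real_derivative) (auto simp: field_simps)
      moreover have "ln (1 - z) / (z * (1 - z)) = ln (1 - z) / z + ln (1 - z) / (1 - z)"
        using z by (simp add: divide_simps) (simp add: algebra_simps)
      moreover have "((\<lambda>z. (ln (1 - z))\<^sup>2 / 2) has_real_derivative - ln (1 - z) / (1 - z)) (at z)"
        using z by (auto intro!: derivative_eq_intros simp: divide_simps)
      ultimately show ?thesis
        unfolding f_def using z by (auto intro!: DERIV_add[THEN DERIV_cong] Li2_has_real_derivative)
    qed
  qed
  then show ?thesis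
    by (simp add: f_def)
qed

text \<open>Both sides vanish at 0 and have the same derivative, since the logarithm of 1 - z^2
  splits into those of 1 - z and 1 + z.\<close>

lemma Li2_duplication:
  fixes x :: real
  assumes "0 < x" "x < 1"
  shows "Li2 x + Li2 (- x) = Li2 (x\<^sup>2) / 2"
proof -
  define f where "f = (\<lambda>x::real. Li2 x + Li2 (- x) - Li2 (x\<^sup>2) / 2)"
  have "f x = f 0"
  proof (rule DERIV_isconst_end[OF assms(1)])
    show "continuous_on {0..x} f"
      unfolding f_def using assms
      by (intro continuous_intros continuous_on_Li2_compose) (auto intro: power_le_one)
    show "(f has_real_derivative 0) (at z)" if "0 < z" "z < x" for z
    proof -
      have z: "0 < z" "z < 1" "z\<^sup>2 < 1"
        using that assms by (auto simp: power_less_one_iff)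
      have "1 - z\<^sup>2 = (1 - z) * (1 + z)"
        by (simp add: algebra_simps power2_eq_square)
      then have ln_eq: "ln (1 - z\<^sup>2) = ln (1 - z) + ln (1 + z)"
        using z by (simp add: ln_mult)
      have "((\<lambda>z. Li2 (- z)) has_real_derivative - ln (1 + z) / z) (at z)"
        using z by (intro Li2_compose_has_real_derivative[where D = "-1"])
          (auto intro!: derivative_eq_intros)
      moreover have "((\<lambda>z. Li2 (z\<^sup>2)) has_real_derivative
          - (ln (1 - z) + ln (1 + z)) / z\<^sup>2 * (2 * z)) (at z)"
        using z by (intro Li2_compose_has_real_derivative)
          (auto intro!: derivative_eq_intros simp: ln_eq)
      ultimately show ?thesis
        unfolding f_def using z
        by (auto intro!: derivative_eq_intros Li2_has_real_derivative
              simp: field_simps power2_eq_square)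
    qed
  qed
  then show ?thesis
    by (simp add: f_def)
qed

section \<open>The value at the inverse square of the golden ratio, and the three-term
  relation\<close>

lemma Li2_inverse_golden_ratio_squared:
  fixes g :: real
  assumes "0 < g" "g\<^sup>2 = 1 - g"
  shows "Li2 (g\<^sup>2) = pi\<^sup>2 / 15 - (ln g)\<^sup>2"
proof -
  have "g < 1"
    using assms zero_less_power2[of g] by linarith
  \<comment> \<open>Landen's identity is applied at \<open>g\<^sup>2 = 1 - g\<close>, which must be
    at most 1/2.\<close>
  have "1 / 2 \<le> g"
  proof (rule ccontr)
    assume "\<not> 1 / 2 \<le> g"
    then have "g\<^sup>2 \<le> (1 / 2)\<^sup>2"
      using assms by (intro power_mono) auto
    with \<open>\<not> 1 / 2 \<le> g\<close> show False
      using assms by (simp add: power2_eq_square)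
  qed
  have ln_eq: "ln (1 - g) = 2 * ln g"
    using assms ln_realpow[of g 2] by simp
  have "1 - g\<^sup>2 = g"
    using assms by simp
  then have "- g\<^sup>2 / (1 - g\<^sup>2) = - g"
    by (simp only:) (simp add: power2_eq_square)
  then have "Li2 (g\<^sup>2) + Li2 (- g) = - (ln g)\<^sup>2 / 2"
    using Li2_Landen[of "g\<^sup>2"] assms \<open>1 / 2 \<le> g\<close> \<open>g < 1\<close> by simp
  moreover have "Li2 g + Li2 (g\<^sup>2) = pi\<^sup>2 / 6 - 2 * (ln g)\<^sup>2"
    using Li2_reflection[of g] assms \<open>g < 1\<close> ln_eq by (simp add: power2_eq_square)
  moreover have "Li2 g + Li2 (- g) = Li2 (g\<^sup>2) / 2"
    using assms \<open>g < 1\<close> by (intro Li2_duplication)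
  \<comment> \<open>The first two equations minus the third eliminate \<open>Li2 g\<close> and
    \<open>Li2 (- g)\<close>, leaving 5/2 times \<open>Li2 (g\<^sup>2)\<close> equal to pi^2/6 - 5/2
    (ln g)^2.\<close>
  ultimately show ?thesis
    by (simp add: field_simps)
qed

text \<open>For each of the three arguments, its difference from 1 is a product of powers of
  \<open>1 - y\<close> and \<open>q\<close>: (1 - y)^2/q, (1 - y)/q and 1/q. So all logarithms in
  the derivative reduce to \<open>ln (1 - y)\<close> and \<open>ln q\<close>, whose coefficients
  cancel. At 0 every term vanishes.\<close>

lemma Li2_three_term:
  fixes y q :: real
  assumes "0 < y" "y < 1"
  defines "q \<equiv> 1 - y + y\<^sup>2"
  shows "Li2 (y / q) - Li2 (y\<^sup>2 / q) + Li2 (- (y * (1 - y)) / q)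
    = ln (1 - y) * ln q - (ln q)\<^sup>2 / 2"
proof -
  \<comment> \<open>This is \<open>q\<close> as a function of the variable, as differentiation
    requires.\<close>
  define r where "r = (\<lambda>y::real. 1 - y + y\<^sup>2)"
  have r_pos: "0 < r z" for z
  proof -
    have "r z = (z - 1 / 2)\<^sup>2 + 3 / 4"
      by (simp add: r_def power2_eq_square algebra_simps)
    then show ?thesis
      by (simp add: add_nonneg_pos)
  qed
  then have r_nz [simp]: "r z \<noteq> 0" for z
    by (metis less_irrefl)
  have r_deriv: "(r has_real_derivative 2 * z - 1) (at z)" for z
    unfolding r_def by (auto intro!: derivative_eq_intros)
  have bounds: "z / r z < 1" "z\<^sup>2 / r z < 1" "z * (1 - z) / r z < 1"
    if "0 \<le> z" "z < 1" for z
  proof -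
    have sq: "r z - z = (1 - z)\<^sup>2" "r z - z * (1 - z) = z\<^sup>2 + (1 - z)\<^sup>2"
      by (simp_all add: r_def power2_eq_square algebra_simps)
    have "0 < (1 - z)\<^sup>2"
      using that by simp
    then have "z < r z" "z * (1 - z) < r z"
      using sq zero_le_power2[of z] by linarith+
    moreover have "z\<^sup>2 < r z"
      using that by (simp add: r_def)
    ultimately show "z / r z < 1" "z\<^sup>2 / r z < 1" "z * (1 - z) / r z < 1"
      using r_pos[of z] by (simp_all add: field_simps)
  qed
  define f where "f = (\<lambda>y. Li2 (y / r y) - Li2 (y\<^sup>2 / r y) + Li2 (- (y * (1 - y)) / r y)
      - ln (1 - y) * ln (r y) + (ln (r y))\<^sup>2 / 2)"
  have "f y = f 0"
  proof (rule DERIV_isconst_end[OF assms(1)])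
    have "continuous_on {0..y} r"
      unfolding r_def by (intro continuous_intros)
    then show "continuous_on {0..y} f"
      unfolding f_def using assms bounds r_pos
      by (intro continuous_intros continuous_on_Li2_compose)
        (auto simp: abs_mult less_imp_le)
    show "(f has_real_derivative 0) (at z)" if "0 < z" "z < y" for z
    proof -
      have z: "0 < z" "z < 1" and R: "0 < r z"
        using that assms r_pos by auto
      have "1 - z / r z = (1 - z)\<^sup>2 / r z" "1 - z\<^sup>2 / r z = (1 - z) / r z"
        "1 - (- (z * (1 - z)) / r z) = 1 / r z"
        by (simp_all add: field_simps) (simp_all add: r_def power2_eq_square algebra_simps)
      then have ln_eq: "ln (1 - z / r z) = 2 * ln (1 - z) - ln (r z)"
        "ln (1 - z\<^sup>2 / r z) = ln (1 - z) - ln (r z)"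
        "ln (1 - (- (z * (1 - z)) / r z)) = - ln (r z)"
        using z R by (simp_all add: ln_div ln_realpow)
      have "((\<lambda>z. z / r z) has_real_derivative (r z - z * (2 * z - 1)) / (r z)\<^sup>2) (at z)"
        using R by (auto intro!: derivative_eq_intros r_deriv simp: power2_eq_square)
      then have d1: "((\<lambda>z. Li2 (z / r z)) has_real_derivative
          - (2 * ln (1 - z) - ln (r z)) * ((r z - z * (2 * z - 1)) / (z * r z))) (at z)"
        using z R bounds[of z] ln_eq
        by (elim Li2_compose_has_real_derivative) (auto simp: power2_eq_square)
      have "((\<lambda>z. z\<^sup>2 / r z) has_real_derivative
          (2 * z * r z - z\<^sup>2 * (2 * z - 1)) / (r z)\<^sup>2) (at z)"
        using R by (auto intro!: derivative_eq_intros r_deriv simp: power2_eq_square)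
      then have d2: "((\<lambda>z. Li2 (z\<^sup>2 / r z)) has_real_derivative
          - (ln (1 - z) - ln (r z)) * ((2 * r z - z * (2 * z - 1)) / (z * r z))) (at z)"
        by (rule Li2_compose_has_real_derivative)
          (use z R bounds[of z] in \<open>simp_all add: ln_eq, simp add: divide_simps power2_eq_square, simp add: algebra_simps\<close>)
      have "((\<lambda>z. - (z * (1 - z)) / r z) has_real_derivative
          ((2 * z - 1) * r z + z * (1 - z) * (2 * z - 1)) / (r z)\<^sup>2) (at z)"
        using R by (auto intro!: derivative_eq_intros r_deriv simp: power2_eq_square algebra_simps)
      \<comment> \<open>The factor 2z - 1 splits off, and \<open>r z + z * (1 - z)\<close> is
        1.\<close>
      moreover have "((2 * z - 1) * r z + z * (1 - z) * (2 * z - 1)) = 2 * z - 1"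
        by (simp add: r_def power2_eq_square algebra_simps)
      ultimately have "((\<lambda>z. - (z * (1 - z)) / r z) has_real_derivative (2 * z - 1) / (r z)\<^sup>2) (at z)"
        by simp
      then have d3: "((\<lambda>z. Li2 (- (z * (1 - z)) / r z)) has_real_derivative
          - ln (r z) * ((2 * z - 1) / (z * (1 - z) * r z))) (at z)"
      proof (rule Li2_compose_has_real_derivative)
        show "\<bar>- (z * (1 - z)) / r z\<bar> < 1" "- (z * (1 - z)) / r z \<noteq> 0"
          using z R bounds[of z] by (auto simp: abs_mult)
        show "- ln (r z) * ((2 * z - 1) / (z * (1 - z) * r z))
          = - ln (1 - (- (z * (1 - z)) / r z)) / (- (z * (1 - z)) / r z) * ((2 * z - 1) / (r z)\<^sup>2)"
          unfolding ln_eq using z R by (simp add: divide_simps power2_eq_square)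
      qed
      have d4: "((\<lambda>z. ln (1 - z) * ln (r z)) has_real_derivative
          - ln (r z) / (1 - z) + ln (1 - z) * (2 * z - 1) / r z) (at z)"
        using z R by (auto intro!: derivative_eq_intros r_deriv simp: field_simps)
      have d5: "((\<lambda>z. (ln (r z))\<^sup>2 / 2) has_real_derivative ln (r z) * (2 * z - 1) / r z) (at z)"
        using z R by (auto intro!: derivative_eq_intros r_deriv simp: field_simps)
      \<comment> \<open>Here \<open>m\<close>, \<open>l\<close> and \<open>s\<close> stand for
        \<open>ln (1 - z)\<close>, \<open>ln (r z)\<close> and \<open>r z\<close>. With the
        logarithms treated as independent variables, the claim becomes a rational identity, which
        clearing denominators turns into a polynomial one.\<close>
      have vanish: "- (2 * m - l) * ((s - z * (2 * z - 1)) / (z * s))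
          - - (m - l) * ((2 * s - z * (2 * z - 1)) / (z * s))
          + - l * ((2 * z - 1) / (z * (1 - z) * s))
          - (- l / (1 - z) + m * (2 * z - 1) / s) + l * (2 * z - 1) / s = 0"
        if "s = 1 - z + z\<^sup>2" "s \<noteq> 0" for m l s
      proof -
        have "z * (1 - z) * s \<noteq> 0"
          using z that by simp
        moreover have "z * (1 - z) * s * (- (2 * m - l) * ((s - z * (2 * z - 1)) / (z * s))
          - - (m - l) * ((2 * s - z * (2 * z - 1)) / (z * s))
          + - l * ((2 * z - 1) / (z * (1 - z) * s))
          - (- l / (1 - z) + m * (2 * z - 1) / s) + l * (2 * z - 1) / s)
          = - (2 * m - l) * (s - z * (2 * z - 1)) * (1 - z)
            + (m - l) * (2 * s - z * (2 * z - 1)) * (1 - z)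
            - l * (2 * z - 1) + l * z * s - m * (2 * z - 1) * z * (1 - z)
            + l * (2 * z - 1) * z * (1 - z)"
          using z that(2) by (simp add: divide_simps) (simp add: algebra_simps)
        moreover have "\<dots> = 0"
          unfolding that(1) by algebra
        ultimately show ?thesis
          by simp
      qed
      show ?thesis
        unfolding f_def
        by (rule DERIV_cong[OF DERIV_add[OF DERIV_diff[OF DERIV_add[OF DERIV_diff[OF d1 d2] d3] d4] d5]])
          (rule vanish[OF r_def[THEN fun_cong] r_nz])
    qed
  qed
  then have "f y = 0"
    by (simp add: f_def r_def)
  moreover have "q = r y"
    by (simp add: q_def r_def)
  ultimately show ?thesis
    by (simp add: f_def)
qed

section \<open>Specialization to the golden ratio\<close>

theorem mainTheorem5:
  fixes \<phi> :: real
  defines "\<phi> \<equiv> (1 + sqrt 5) / 2"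
  shows "Li2 (1 - (1 + sqrt (1 + 4 / \<phi>)) / (2 * \<phi>)) - Li2 ((1 - sqrt (1 + 4 / \<phi>)) / (2 * \<phi>))
       = - (1 / 2) * (ln \<phi>) ^ 2 + ln (2 / (sqrt (4 / \<phi> + 1) + 1)) * ln \<phi> + pi ^ 2 / 15"
proof -
  define g where "g = 1 / \<phi>"
  define s where "s = sqrt (1 + 4 / \<phi>)"
  define y where "y = (s - 1) / (s + 1)"
  define q where "q = 1 - y + y\<^sup>2"
  have \<phi>: "0 < \<phi>" "\<phi>\<^sup>2 = \<phi> + 1"
    by (auto simp: \<phi>_def power2_eq_square field_simps intro: add_pos_pos)
  then have g: "0 < g" "g\<^sup>2 = 1 - g" "\<phi> = 1 / g"
    by (auto simp: g_def field_simps power2_eq_square)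
  have "1 < s"
    using \<phi> by (simp add: s_def)
  have s2: "s\<^sup>2 = 1 + 4 * g"
    using \<phi> by (simp add: s_def g_def)
  \<comment> \<open>The value of \<open>1 - y\<close> is the argument of the mixed logarithm term in
    the theorem.\<close>
  have y: "0 < y" "y < 1" "1 - y = 2 / (s + 1)"
    using \<open>1 < s\<close> by (auto simp: y_def field_simps)
  have "q = (s\<^sup>2 + 3) / (s + 1)\<^sup>2"
    using \<open>1 < s\<close> by (simp add: q_def y_def divide_simps) (simp add: power2_eq_square algebra_simps)
  then have q: "q = 4 * (1 + g) / (s + 1)\<^sup>2"
    by (simp add: s2)
  \<comment> \<open>The golden ratio equation reads g(1 + g) = 1. Thus the factor 1/(1 + g) that
    \<open>q\<close> contributes to each of the three arguments becomes \<open>g\<close>.\<close>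
  have ginv: "1 / (1 + g) = g"
    using g by (simp add: field_simps power2_eq_square)
  have "0 < q"
    using g \<open>1 < s\<close> by (simp add: q)
  have yq: "y / q = (s\<^sup>2 - 1) / 4 * (1 / (1 + g))"
    using \<open>1 < s\<close> g by (simp add: y_def q divide_simps) (simp add: power2_eq_square algebra_simps)
  then have x: "y / q = g\<^sup>2"
    unfolding ginv s2 by (simp add: power2_eq_square)
  have "y\<^sup>2 / q = (s - 1)\<^sup>2 / 4 * (1 / (1 + g))"
    using \<open>1 < s\<close> g by (simp add: y_def q divide_simps)
  also have "\<dots> = 1 - (1 + s) / (2 * \<phi>)"
    unfolding ginv using s2 g by (simp add: power2_eq_square) algebra
  finally have u: "1 - (1 + s) / (2 * \<phi>) = y\<^sup>2 / q"
    by simp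
  have "- (y * (1 - y)) / q = - (s - 1) / 2 * (1 / (1 + g))"
    using \<open>1 < s\<close> g by (simp add: y_def q divide_simps) (simp add: power2_eq_square algebra_simps)
  also have "\<dots> = (1 - s) / (2 * \<phi>)"
    unfolding ginv g(3) by (simp add: algebra_simps)
  finally have v: "(1 - s) / (2 * \<phi>) = - (y * (1 - y)) / q"
    by simp
  \<comment> \<open>This expresses \<open>ln q\<close> through \<open>ln (1 - y)\<close> and
    \<open>ln \<phi>\<close>, the only logarithms in the result.\<close>
  have "q = (1 - y)\<^sup>2 / g"
  proof -
    have "1 + g = 1 / g"
      using g by (simp add: field_simps power2_eq_square)
    then show ?thesis
      unfolding q y(3) using \<open>1 < s\<close> by (simp add: power_divide)
  qed
  then have lnq: "ln q = 2 * ln (1 - y) + ln \<phi>"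
    using g y(1,2) by (simp add: ln_div ln_realpow)
  have lng: "ln g = - ln \<phi>"
    using \<phi> by (simp add: g_def ln_div)
  have "Li2 (y\<^sup>2 / q) - Li2 (- (y * (1 - y)) / q)
      = pi\<^sup>2 / 15 - (ln \<phi>)\<^sup>2 - ln (1 - y) * ln q + (ln q)\<^sup>2 / 2"
    using Li2_three_term[OF y(1,2)] Li2_inverse_golden_ratio_squared[OF g(1,2)]
    by (simp add: lng x flip: q_def)
  \<comment> \<open>After substituting \<open>lnq\<close>, the squares of \<open>ln (1 - y)\<close>
    cancel, and half of the square of \<open>ln \<phi>\<close> is returned.\<close>
  also have "\<dots> = - (1 / 2) * (ln \<phi>)\<^sup>2 + ln (1 - y) * ln \<phi> + pi\<^sup>2 / 15"
    unfolding lnq by (simp add: power2_eq_square field_simps)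
  finally show ?thesis
    unfolding s_def[symmetric] u v y(3) by (simp add: s_def add.commute)
qed

end
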